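(* Let $G$ be an arbitrary finite simple graph with $n$ vertices, $e$ edges and $t$ triangles, and let $P$ be a greedy partition of $G$. Then $t \ge r(P)\cdot\left(e - \frac{n^2}{4}\right)$.
   Context: A good partition $P$ of $V(G)$ is a partition of $V(G)$ into disjoint sets $C_1, C_2, \dots, C_r$ (the cliques of $P$), each inducing a complete subgraph of $G$, indexed so that $|C_1|\le |C_2|\le \dots\le |C_r|$. Its size is $r(P)=r$, the number of cliques. A good partition is a greedy partition if for every $i \ge 1$ the set $C_1\cup C_2\cup\dots\cup C_i$ induces a subgraph of $G$ containing no complete subgraph on $|C_i|+1$ vertices. (Equivalently, a greedy partition is obtained by repeatedly removing a maximum-size clique of the remaining graph, taken as the last remaining part.) *)

theory Defs
  imports Complex_Main
begin

definition simple_graph :: "'a set \<Rightarrow> 'a set set \<Rightarrow> bool" where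
  "simple_graph V E \<longleftrightarrow> finite V \<and> (\<forall>e\<in>E. e \<subseteq> V \<and> card e = 2)"

definition is_clique :: "'a set \<Rightarrow> 'a set set \<Rightarrow> 'a set \<Rightarrow> bool" where
  "is_clique V E C \<longleftrightarrow> C \<subseteq> V \<and> (\<forall>x\<in>C. \<forall>y\<in>C. x \<noteq> y \<longrightarrow> {x, y} \<in> E)"

definition triangles :: "'a set \<Rightarrow> 'a set set \<Rightarrow> 'a set set" where
  "triangles V E = {T. T \<subseteq> V \<and> card T = 3 \<and> is_clique V E T}"

text \<open>A good partition: list of pairwise disjoint nonempty cliques C_1,...,C_r
  covering V, sorted by nondecreasing size (list index i corresponds to C_(i+1)).\<close>
definition good_partition :: "'a set \<Rightarrow> 'a set set \<Rightarrow> 'a set list \<Rightarrow> bool" where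
  "good_partition V E P \<longleftrightarrow>
     (\<forall>C\<in>set P. C \<noteq> {} \<and> is_clique V E C) \<and>
     (\<forall>i<length P. \<forall>j<length P. i \<noteq> j \<longrightarrow> P ! i \<inter> P ! j = {}) \<and>
     \<Union>(set P) = V \<and>
     sorted (map card P)"

definition greedy_partition :: "'a set \<Rightarrow> 'a set set \<Rightarrow> 'a set list \<Rightarrow> bool" where
  "greedy_partition V E P \<longleftrightarrow> good_partition V E P \<and>
     (\<forall>i<length P. \<not> (\<exists>K. K \<subseteq> \<Union>(set (take (Suc i) P)) \<and> is_clique V E K
                          \<and> card K = card (P ! i) + 1))"

end

theory Submission
  imports Defs
begin

text \<open>
  Write \<open>r\<close> for the number of cliques. Call \<open>S\<close> admissible if, for every \<open>i\<close>, the set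
  \<open>S \<inter> (C\<^sub>1 \<union> \<dots> \<union> C\<^sub>i)\<close> contains no clique of size \<open>|C\<^sub>i|\<close>, and let \<open>N\<close> be an
  admissible set minimising \<open>w(S) = e(S) - r |S|\<close>. Build the graph from \<open>N\<close> by adding the remaining
  vertices, those of \<open>C\<^sub>r\<close> first and those of \<open>C\<^sub>1\<close> last. When \<open>x \<in> C\<^sub>i\<close> is added, its current
  neighbourhood \<open>S\<close> is admissible: for \<open>j < i\<close> because only vertices of \<open>N\<close> are present in
  \<open>C\<^sub>1 \<union> \<dots> \<union> C\<^sub>j\<close>, and for \<open>j \<ge> i\<close> because a clique of size \<open>|C\<^sub>j|\<close> in \<open>S\<close> together with \<open>x\<close>
  would contradict greediness. So this step increases \<open>t - r e\<close> by \<open>w(S) \<ge> w(N)\<close>. No \<open>C\<^sub>i\<close> lies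
  inside \<open>N\<close>, hence \<open>m = |V - N| \<ge> r\<close>, and
  \<open>t - r e \<ge> t(N) - r e(N) + m (e(N) - r |N|) \<ge> - r m |N| \<ge> - r n\<^sup>2 / 4\<close>.
\<close>

section \<open>Edge and triangle counts when one vertex is added\<close>

definition edges_in :: "'a set set \<Rightarrow> 'a set \<Rightarrow> 'a set set" where
  "edges_in E W = {e \<in> E. e \<subseteq> W}"

definition nbrs_in :: "'a set set \<Rightarrow> 'a set \<Rightarrow> 'a \<Rightarrow> 'a set" where
  "nbrs_in E W x = {y \<in> W. {x, y} \<in> E}"

lemma finite_edges_in: "finite W \<Longrightarrow> finite (edges_in E W)"
  by (rule finite_subset[of _ "Pow W"]) (auto simp: edges_in_def)

lemma finite_triangles: "finite W \<Longrightarrow> finite (triangles W E)"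
  by (rule finite_subset[of _ "Pow W"]) (auto simp: triangles_def)

lemma card_edges_in_insert:
  assumes "finite W" and "x \<notin> W" and two: "\<And>e. e \<in> E \<Longrightarrow> card e = 2"
  shows "card (edges_in E (insert x W)) = card (edges_in E W) + card (nbrs_in E W x)"
proof -
  have split: "edges_in E (insert x W) = edges_in E W \<union> (\<lambda>y. {x, y}) ` nbrs_in E W x"
  proof
    show "edges_in E (insert x W) \<subseteq> edges_in E W \<union> (\<lambda>y. {x, y}) ` nbrs_in E W x"
    proof
      fix e assume e: "e \<in> edges_in E (insert x W)"
      show "e \<in> edges_in E W \<union> (\<lambda>y. {x, y}) ` nbrs_in E W x"
      proof (cases "x \<in> e")
        case True
        have "card e = 2" using e two by (simp add: edges_in_def)
        with True obtain y where "e = {x, y}" "y \<noteq> x"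
          by (auto simp: card_2_iff)
        with e show ?thesis by (auto simp: edges_in_def nbrs_in_def)
      next
        case False
        with e show ?thesis by (auto simp: edges_in_def)
      qed
    qed
  qed (auto simp: edges_in_def nbrs_in_def)
  have "inj_on (\<lambda>y. {x, y}) (nbrs_in E W x)"
    by (auto simp: inj_on_def doubleton_eq_iff)
  moreover have "edges_in E W \<inter> (\<lambda>y. {x, y}) ` nbrs_in E W x = {}"
    using \<open>x \<notin> W\<close> by (auto simp: edges_in_def)
  ultimately show ?thesis
    using \<open>finite W\<close> unfolding split
    by (subst card_Un_disjoint) (auto simp: card_image finite_edges_in nbrs_in_def)
qed

text \<open>A triangle through \<open>x\<close> is \<open>x\<close> together with an edge between
  two of its neighbours, so \<open>insert x\<close> maps the edges inside the neighbourhood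
  bijectively to the new triangles.\<close>

lemma card_triangles_insert:
  assumes "finite W" and "x \<notin> W" and two: "\<And>e. e \<in> E \<Longrightarrow> card e = 2"
  shows "card (triangles (insert x W) E)
           = card (triangles W E) + card (edges_in E (nbrs_in E W x))"
proof -
  let ?N = "nbrs_in E W x"
  have N: "?N \<subseteq> W" by (auto simp: nbrs_in_def)
  have split: "triangles (insert x W) E = triangles W E \<union> insert x ` edges_in E ?N"
  proof (intro equalityI subsetI)
    fix T assume T: "T \<in> triangles (insert x W) E"
    show "T \<in> triangles W E \<union> insert x ` edges_in E ?N"
    proof (cases "x \<in> T")
      case True
      then have "card (T - {x}) = 2" using T by (simp add: triangles_def)
      then obtain y z where yz: "T - {x} = {y, z}" "y \<noteq> z" by (auto simp: card_2_iff)
      then have "T = insert x {y, z}" "y \<noteq> x" "z \<noteq> x" using True by auto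
      moreover have "{y, z} \<in> edges_in E ?N"
        using T calculation yz(2) by (auto simp: triangles_def is_clique_def edges_in_def nbrs_in_def)
      ultimately show ?thesis by blast
    next
      case False
      with T show ?thesis by (auto simp: triangles_def is_clique_def)
    qed
  next
    fix T assume "T \<in> triangles W E \<union> insert x ` edges_in E ?N"
    then show "T \<in> triangles (insert x W) E"
    proof
      assume "T \<in> triangles W E"
      then show ?thesis by (auto simp: triangles_def is_clique_def)
    next
      assume "T \<in> insert x ` edges_in E ?N"
      then obtain e where e: "T = insert x e" "e \<in> E" "e \<subseteq> ?N" by (auto simp: edges_in_def)
      from two[OF e(2)] obtain y z where yz: "e = {y, z}" "y \<noteq> z" by (auto simp: card_2_iff)
      with e have "{x, y} \<in> E" "{x, z} \<in> E" "y \<in> W" "z \<in> W" by (auto simp: nbrs_in_def)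
      moreover from this \<open>x \<notin> W\<close> have "y \<noteq> x" "z \<noteq> x" by auto
      ultimately show ?thesis
        using e yz by (auto simp: triangles_def is_clique_def insert_commute)
    qed
  qed
  have "inj_on (insert x) (edges_in E ?N)"
  proof (rule inj_onI)
    fix e e' assume "e \<in> edges_in E ?N" "e' \<in> edges_in E ?N" "insert x e = insert x e'"
    moreover from this have "x \<notin> e" "x \<notin> e'"
      using N \<open>x \<notin> W\<close> by (auto simp: edges_in_def)
    ultimately show "e = e'" by (metis insert_ident)
  qed
  moreover have "triangles W E \<inter> insert x ` edges_in E ?N = {}"
    using \<open>x \<notin> W\<close> by (auto simp: triangles_def)
  moreover have "finite ?N" using N \<open>finite W\<close> finite_subset by blast
  ultimately show ?thesis
    using \<open>finite W\<close> unfolding split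
    by (subst card_Un_disjoint) (auto simp: card_image finite_edges_in finite_triangles)
qed

section \<open>Growth of \<open>t - r e\<close> along a sequence of added vertices\<close>

definition nbhd_weight :: "real \<Rightarrow> 'a set set \<Rightarrow> 'a set \<Rightarrow> real" where
  "nbhd_weight r E S = real (card (edges_in E S)) - r * real (card S)"

definition tri_edge_diff :: "real \<Rightarrow> 'a set set \<Rightarrow> 'a set \<Rightarrow> real" where
  "tri_edge_diff r E W = real (card (triangles W E)) - r * real (card (edges_in E W))"

lemma tri_edge_diff_insert:
  assumes "finite W" and "x \<notin> W" and "\<And>e. e \<in> E \<Longrightarrow> card e = 2"
  shows "tri_edge_diff r E (insert x W)
           = tri_edge_diff r E W + nbhd_weight r E (nbrs_in E W x)"
  using card_edges_in_insert[OF assms] card_triangles_insert[OF assms]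
  by (simp add: tri_edge_diff_def nbhd_weight_def algebra_simps)

text \<open>Hypothesis \<open>ge\<close> ranges over all \<open>U\<close> so that it covers whatever
  vertices are present when \<open>x\<close> is added; the order within \<open>A\<close> is then
  immaterial.\<close>

lemma tri_edge_diff_Un_ge:
  assumes "finite A" and "finite W" and "A \<inter> W = {}" and two: "\<And>e. e \<in> E \<Longrightarrow> card e = 2"
    and ge: "\<And>x U. x \<in> A \<Longrightarrow> U \<subseteq> W \<union> A \<Longrightarrow> c \<le> nbhd_weight r E (nbrs_in E U x)"
  shows "tri_edge_diff r E W + real (card A) * c \<le> tri_edge_diff r E (W \<union> A)"
  using assms(1,3) ge
proof (induction A rule: finite_induct)
  case empty
  then show ?case by simp
next
  case (insert x A)
  have "tri_edge_diff r E W + real (card A) * c \<le> tri_edge_diff r E (W \<union> A)"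
    using insert.prems by (intro insert.IH) auto
  moreover have "c \<le> nbhd_weight r E (nbrs_in E (W \<union> A) x)"
    using insert.prems by auto
  moreover have "tri_edge_diff r E (insert x (W \<union> A))
      = tri_edge_diff r E (W \<union> A) + nbhd_weight r E (nbrs_in E (W \<union> A) x)"
    using insert \<open>finite W\<close> two by (intro tri_edge_diff_insert) auto
  ultimately show ?case
    using insert.hyps by (simp add: algebra_simps)
qed

section \<open>Admissible sets and the greedy condition\<close>

text \<open>Excluding the exact size \<open>card (P ! i)\<close> also excludes larger finite
  cliques, since subsets of cliques are cliques. The excluded size is one below that in
  \<open>greedy_partition\<close>, which leaves room for one common neighbour.\<close>

definition admissible :: "'a set \<Rightarrow> 'a set set \<Rightarrow> 'a set list \<Rightarrow> 'a set \<Rightarrow> bool" where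
  "admissible V E P S \<longleftrightarrow> S \<subseteq> V \<and>
     (\<forall>i<length P. \<forall>K. K \<subseteq> S \<inter> \<Union>(set (take (Suc i) P)) \<longrightarrow> is_clique V E K
        \<longrightarrow> card K \<noteq> card (P ! i))"

lemma admissible_nbrs_in:
  assumes graph: "simple_graph V E" and greedy: "greedy_partition V E P"
    and N: "admissible V E P N" and i: "i < length P" and x: "x \<in> P ! i"
    and U: "U \<subseteq> N \<union> \<Union>(set (drop i P))"
  shows "admissible V E P (nbrs_in E U x)"
  unfolding admissible_def
proof (intro conjI allI impI)
  show "nbrs_in E U x \<subseteq> V"
    using graph by (auto simp: simple_graph_def nbrs_in_def)
next
  fix j K
  assume j: "j < length P"
    and K: "K \<subseteq> nbrs_in E U x \<inter> \<Union>(set (take (Suc j) P))" and clique: "is_clique V E K"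
  have xV: "x \<in> V"
    using greedy x nth_mem[OF i] by (auto simp: greedy_partition_def good_partition_def)
  show "card K \<noteq> card (P ! j)"
  proof (cases "i \<le> j")
    case True
    have edge: "{x, y} \<in> E" if "y \<in> K" for y
      using that K by (auto simp: nbrs_in_def)
    \<comment> \<open>Otherwise \<open>{x, x}\<close> would be an edge with a single
      element.\<close>
    have "x \<notin> K"
      using edge[of x] graph by (force simp: simple_graph_def)
    moreover have "finite K"
      using clique graph by (auto simp: is_clique_def simple_graph_def intro: finite_subset)
    moreover have "is_clique V E (insert x K)"
      using clique xV edge by (auto simp: is_clique_def insert_commute)
    moreover have "P ! i \<in> set (take (Suc j) P)"
      using i j True by (auto simp: in_set_conv_nth intro!: exI[of _ i])
    then have "insert x K \<subseteq> \<Union>(set (take (Suc j) P))"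
      using K x by blast
    \<comment> \<open>If \<open>card K = card (P ! j)\<close>, then \<open>insert x K\<close> has
      exactly the size that greediness forbids.\<close>
    ultimately show ?thesis
      using greedy j unfolding greedy_partition_def by (auto dest!: spec[of _ j] spec[of _ "insert x K"])
  next
    case False
    \<comment> \<open>Parts of index at least \<open>i\<close> miss the first \<open>j + 1\<close>
      parts, so there \<open>U\<close> has only vertices of \<open>N\<close> and admissibility of
      \<open>N\<close> applies.\<close>
    have "\<Union>(set (drop i P)) \<inter> \<Union>(set (take (Suc j) P)) = {}"
    proof -
      have "C \<inter> D = {}" if C: "C \<in> set (drop i P)" and D: "D \<in> set (take (Suc j) P)" for C D
      proof -
        obtain k where k: "C = P ! k" "i \<le> k" "k < length P"
          using C by (auto simp: in_set_conv_nth)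
        obtain l where l: "D = P ! l" "l \<le> j"
          using D by (auto simp: in_set_conv_nth)
        have "l < length P" "k \<noteq> l" using k l False j by auto
        then show ?thesis
          using greedy k l by (simp add: greedy_partition_def good_partition_def)
      qed
      then show ?thesis by blast
    qed
    then have "K \<subseteq> N \<inter> \<Union>(set (take (Suc j) P))"
      using K U unfolding nbrs_in_def by blast
    then show ?thesis
      using N j clique unfolding admissible_def by blast
  qed
qed

text \<open>A part inside \<open>N\<close> would itself be a clique of forbidden size, so each part
  has a vertex outside \<open>N\<close>; disjointness makes these vertices distinct.\<close>

lemma length_le_card_Diff_admissible:
  assumes fin: "finite V" and good: "good_partition V E P" and N: "admissible V E P N"
  shows "length P \<le> card (V - N)"
proof -
  have "\<exists>x. x \<in> P ! i - N" if i: "i < length P" for i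
  proof (rule ccontr)
    assume "\<not> ?thesis"
    moreover have "P ! i \<in> set (take (Suc i) P)"
      using i by (auto simp: in_set_conv_nth intro!: exI[of _ i])
    ultimately have "P ! i \<subseteq> N \<inter> \<Union>(set (take (Suc i) P))" by blast
    moreover have "is_clique V E (P ! i)"
      using good i by (auto simp: good_partition_def)
    ultimately show False using N i unfolding admissible_def by blast
  qed
  then obtain g where g: "\<And>i. i < length P \<Longrightarrow> g i \<in> P ! i - N" by metis
  have "inj_on g {..<length P}"
  proof (rule inj_onI, rule ccontr)
    fix i j assume "i \<in> {..<length P}" "j \<in> {..<length P}" "g i = g j" "i \<noteq> j"
    moreover from this have "P ! i \<inter> P ! j = {}"
      using good by (simp add: good_partition_def)
    ultimately show False using g[of i] g[of j] by auto
  qed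
  moreover have "g ` {..<length P} \<subseteq> V - N"
    using g good by (fastforce simp: good_partition_def)
  ultimately show ?thesis
    using card_inj_on_le[of g "{..<length P}" "V - N"] fin by simp
qed

text \<open>Downward induction from \<open>k = length P\<close>, where only \<open>N\<close> is
  present, matches adding the last parts first; \<open>k = 0\<close> reaches all of
  \<open>V\<close>.\<close>

lemma tri_edge_diff_drop_ge:
  assumes graph: "simple_graph V E" and greedy: "greedy_partition V E P"
    and N: "admissible V E P N"
    and min: "\<And>S. admissible V E P S \<Longrightarrow> nbhd_weight r E N \<le> nbhd_weight r E S"
    and "k \<le> length P"
  shows "tri_edge_diff r E N + real (card (\<Union>(set (drop k P)) - N)) * nbhd_weight r E N
           \<le> tri_edge_diff r E (N \<union> \<Union>(set (drop k P)))"
  using \<open>k \<le> length P\<close>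
proof (induction k rule: inc_induct)
  case base
  then show ?case by simp
next
  case (step k)
  let ?D = "\<Union>(set (drop (Suc k) P))"
  let ?A = "P ! k - (N \<union> ?D)"
  have drop: "\<Union>(set (drop k P)) = P ! k \<union> ?D"
    using step.hyps by (simp flip: Cons_nth_drop_Suc)
  have "\<Union>(set P) = V"
    using greedy by (simp add: greedy_partition_def good_partition_def)
  then have sub: "P ! k \<union> ?D \<subseteq> V"
    using drop set_drop_subset[of k P] by blast
  have finV: "finite V" using graph by (simp add: simple_graph_def)
  have fin: "finite N" "finite ?D" "finite ?A"
    using N sub finite_subset[OF _ finV] by (auto simp: admissible_def)
  have "tri_edge_diff r E (N \<union> ?D) + real (card ?A) * nbhd_weight r E N
          \<le> tri_edge_diff r E ((N \<union> ?D) \<union> ?A)"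
  proof (rule tri_edge_diff_Un_ge)
    fix x U assume x: "x \<in> ?A" and U: "U \<subseteq> (N \<union> ?D) \<union> ?A"
    have "admissible V E P (nbrs_in E U x)"
    proof (rule admissible_nbrs_in[OF graph greedy N])
      show "U \<subseteq> N \<union> \<Union>(set (drop k P))" unfolding drop using U by blast
    qed (use x step.hyps in auto)
    then show "nbhd_weight r E N \<le> nbhd_weight r E (nbrs_in E U x)" by (rule min)
  qed (use fin graph in \<open>auto simp: simple_graph_def\<close>)
  moreover have "(N \<union> ?D) \<union> ?A = N \<union> \<Union>(set (drop k P))" unfolding drop by blast
  moreover have "\<Union>(set (drop k P)) - N = (?D - N) \<union> ?A" unfolding drop by blast
  then have "card (\<Union>(set (drop k P)) - N) = card (?D - N) + card ?A"
    using fin by (simp only:) (rule card_Un_disjoint, auto)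
  ultimately show ?case
    using step.IH by (simp add: algebra_simps)
qed

section \<open>The minimiser and the final estimate\<close>

theorem theorem2:
  fixes V :: "'a set" and E :: "'a set set" and P :: "'a set list"
  assumes "simple_graph V E"
    and "greedy_partition V E P"
  shows "real (card (triangles V E)) \<ge>
           real (length P) * (real (card E) - (real (card V))^2 / 4)"
proof -
  let ?r = "real (length P)"
  have good: "good_partition V E P" and finV: "finite V"
    using assms by (auto simp: greedy_partition_def simple_graph_def)
  \<comment> \<open>Parts are finite and nonempty, so the empty clique never has a forbidden size;
    hence there is a set to minimise over.\<close>
  have "admissible V E P {}"
  proof -
    have "card (P ! i) \<noteq> 0" if "i < length P" for i
    proof -
      have "P ! i \<noteq> {}" "P ! i \<subseteq> V"
        using good that by (auto simp: good_partition_def is_clique_def)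
      then show ?thesis using finite_subset[OF _ finV] by auto
    qed
    then show ?thesis by (auto simp: admissible_def)
  qed
  moreover have "finite {S. admissible V E P S}"
    by (rule finite_subset[of _ "Pow V"]) (use finV in \<open>auto simp: admissible_def\<close>)
  ultimately obtain N where N: "admissible V E P N"
    and min: "\<And>S. admissible V E P S \<Longrightarrow> nbhd_weight ?r E N \<le> nbhd_weight ?r E S"
    using ex_min_if_finite[of "nbhd_weight ?r E ` {S. admissible V E P S}"]
    by (auto simp: not_less)
  define m where "m = real (card (V - N))"
  define k where "k = real (card N)"
  define d where "d = real (card (edges_in E N))"
  have NV: "N \<subseteq> V" using N by (simp add: admissible_def)
  have "\<Union>(set P) = V" using good by (simp add: good_partition_def)
  moreover have "edges_in E V = E" using assms by (auto simp: edges_in_def simple_graph_def)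
  moreover have "N \<union> V = V" using NV by blast
  ultimately have lower: "tri_edge_diff ?r E N + m * (d - ?r * k)
      \<le> real (card (triangles V E)) - ?r * real (card E)"
    using tri_edge_diff_drop_ge[OF assms N min, of 0]
    by (simp add: tri_edge_diff_def nbhd_weight_def m_def k_def d_def)
  have "card V = card N + card (V - N)"
    using NV finV by (metis card_Diff_subset card_mono finite_subset le_add_diff_inverse)
  \<comment> \<open>With \<open>m + k\<close> equal to the number of vertices, this is the AM-GM
    inequality for \<open>m\<close> and \<open>k\<close>.\<close>
  then have "real (card V) ^ 2 / 4 - m * k = ((m - k) / 2) ^ 2"
    by (simp add: m_def k_def power2_eq_square field_simps)
  then have "m * k \<le> real (card V) ^ 2 / 4"
    by (metis diff_ge_0_iff_ge zero_le_power2)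
  then have "?r * (m * k) \<le> ?r * (real (card V) ^ 2 / 4)"
    by (rule mult_left_mono) simp
  \<comment> \<open>The gain \<open>m * d\<close> pays for the loss \<open>?r * d\<close> from the
    edges inside \<open>N\<close>.\<close>
  moreover have "?r * d \<le> m * d"
    using length_le_card_Diff_admissible[OF finV good N]
    by (intro mult_right_mono) (auto simp: m_def d_def)
  moreover have "- (?r * d) \<le> tri_edge_diff ?r E N"
    by (simp add: tri_edge_diff_def d_def)
  ultimately show ?thesis
    using lower by (simp add: algebra_simps)
qed

end
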